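(* Let $X=\{x,v_0,v_1,v_2,\ldots\}$ be a countable alphabet, and let $W$ be the free $\Bbbk[\partial]$-module generated by $X$, equipped with the conformal product determined (via sesquilinearity) by $$(v_k\,{}_{\circ(\lambda)}\,x)=(\partial+\lambda)^k v_k,\qquad (x\,{}_{\circ(\lambda)}\,x)=(x\,{}_{\circ(\lambda)}\,v_k)=(v_k\,{}_{\circ(\lambda)}\,v_p)=0,\qquad k,p\in\mathbb Z_+ .$$ Then the Novikov conformal algebra $W$ cannot be embedded into $C^{(D)}$ for any commutative conformal algebra $C$ with a derivation $D$.
   Context: Throughout, $\Bbbk$ is a field of characteristic zero, $\mathbb Z_+$ is the set of nonnegative integers. Conformal algebra: a linear space $C$ over $\Bbbk$ with a linear operator $\partial: C\to C$ and a bilinear operation $(\cdot\,{}_{(\lambda)}\,\cdot): C\times C\to C[\lambda]$ ($\lambda$ a formal variable) satisfying sesquilinearity: $(\partial a\,{}_{(\lambda)}\, b) = -\lambda (a\,{}_{(\lambda)}\, b)$ and $\partial(a\,{}_{(\lambda)}\, b) = (a\,{}_{(\lambda)}\,\partial b) - \lambda (a\,{}_{(\lambda)}\, b)$ for all $a,b\in C$. The $n$-products $(a\,{}_{(n)}\,b)\in C$, $n\in\mathbb Z_+$, are defined by $(a\,{}_{(\lambda)}\, b)=\sum_{n\ge 0}\frac{\lambda^n}{n!}(a\,{}_{(n)}\,b)$. On a free $\Bbbk[\partial]$-module a conformal product is uniquely determined by its values on a basis. An embedding of conformal algebras is an injective linear map commuting with $\partial$ and preserving all $n$-products. In identities, $(a\,{}_{(-\partial-\lambda)}\,b)$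 denotes the result of substituting the operator $-\partial-\lambda$ for the variable $\lambda$ in $(a\,{}_{(\lambda)}\,b)$, i.e. $\sum_{n\ge 0}\frac{(-\partial-\lambda)^n}{n!}(a\,{}_{(n)}\,b)$. Commutative conformal algebra: a conformal algebra satisfying $a\,{}_{(\lambda)}\,(b\,{}_{(\mu)}\,c) = (a\,{}_{(\lambda)}\,b)\,{}_{(\lambda+\mu)}\,c$ and $(a\,{}_{(\lambda)}\,b)=(b\,{}_{(-\partial-\lambda)}\,a)$. Novikov conformal algebra: a conformal algebra satisfying $(a\,{}_{(\lambda)}\,b)\,{}_{(\lambda+\mu)}\,c - a\,{}_{(\lambda)}\,(b\,{}_{(\mu)}\,c) = (a\,{}_{(\lambda)}\,c)\,{}_{(-\partial-\mu)}\,b - a\,{}_{(\lambda)}\,(c\,{}_{(-\partial-\mu)}\,b)$ and $a\,{}_{(\lambda)}\,(b\,{}_{(\mu)}\,c)=b\,{}_{(\mu)}\,(a\,{}_{(\lambda)}\,c)$. The conformal algebra $W$ of the claim is a Novikov conformal algebra. A derivation of a conformal algebra $C$ is a linear map $D:C\to C$ with $D\partial=\partial D$ and $D(a\,{}_{(\lambda)}\,b)=(D(a)\,{}_{(\lambda)}\,b)+(a\,{}_{(\lambda)}\,D(b))$. If $C$ is a commutative conformal algebra with a derivation $D$, then $C^{(D)}$ denotes the Novikov conformal algebra on the same space $C$ with the same $\partial$ and the operation $(a\,{}_{\circ(\lambda)}\,b)=(Da\,{}_{(\lambda)}\,b)$. *)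

theory Defs
  imports "HOL-Computational_Algebra.Polynomial" "HOL-Library.Poly_Mapping"
begin

text \<open>
  For a linear space \<open>C\<close>, the space of polynomials in one formal variable with coefficients in
  \<open>C\<close> is the type \<open>'c poly\<close>, on which multiplication by the variable is \<^term>\<open>pCons 0\<close> and a
  linear operator of \<open>C\<close> acts as \<^term>\<open>map_poly\<close>. Polynomials in two variables \<open>\<lambda>, \<mu>\<close> live in
  \<open>'c poly poly\<close>, where the inner variable is \<open>\<lambda>\<close> and the outer one is \<open>\<mu>\<close>.

  \<open>op_subst T i p\<close> is the substitution of the operator \<open>T\<close> of a space \<open>M\<close> for the variable of \<open>p\<close>,
  where the coefficients of \<open>p\<close> are transported to \<open>M\<close> by \<open>i\<close>.
\<close>

definition op_subst :: "('m::ab_group_add \<Rightarrow> 'm) \<Rightarrow> ('c::zero \<Rightarrow> 'm) \<Rightarrow> 'c poly \<Rightarrow> 'm" where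
  "op_subst T i p = (\<Sum>n\<le>degree p. (T ^^ n) (i (coeff p n)))"

definition const1 :: "'c::zero \<Rightarrow> 'c poly" where
  "const1 c = [:c:]"

definition const2 :: "'c::zero \<Rightarrow> 'c poly poly" where
  "const2 c = [:[:c:]:]"

definition lam_op :: "'c::zero poly poly \<Rightarrow> 'c poly poly" where
  "lam_op = map_poly (pCons 0)"

definition mu_op :: "'c::zero poly poly \<Rightarrow> 'c poly poly" where
  "mu_op = pCons 0"

definition lam_plus_mu :: "'c::ab_group_add poly poly \<Rightarrow> 'c poly poly" where
  "lam_plus_mu p = lam_op p + mu_op p"

text \<open>The operators \<open>- \<partial> - \<lambda>\<close> in one variable and \<open>- \<partial> - \<mu>\<close> in two variables.\<close>

definition neg_d_var :: "('c::ab_group_add \<Rightarrow> 'c) \<Rightarrow> 'c poly \<Rightarrow> 'c poly" where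
  "neg_d_var d p = - map_poly d p - pCons 0 p"

definition neg_d_mu :: "('c::ab_group_add \<Rightarrow> 'c) \<Rightarrow> 'c poly poly \<Rightarrow> 'c poly poly" where
  "neg_d_mu d p = - map_poly (map_poly d) p - mu_op p"

text \<open>
  \<open>lprod a b\<close> is \<open>(a \<^sub>(\<^sub>\<lambda>\<^sub>) b)\<close> as a polynomial in \<open>\<lambda>\<close>.
\<close>

locale conformal_algebra = vector_space scale
  for scale :: "'k::field_char_0 \<Rightarrow> 'c::ab_group_add \<Rightarrow> 'c" +
  fixes d :: "'c \<Rightarrow> 'c"
    and lprod :: "'c \<Rightarrow> 'c \<Rightarrow> 'c poly"
  assumes linear_d: "Vector_Spaces.linear scale scale d"
    and linear_lprod_left:
      "Vector_Spaces.linear scale (\<lambda>r. map_poly (scale r)) (\<lambda>a. lprod a b)"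
    and linear_lprod_right:
      "Vector_Spaces.linear scale (\<lambda>r. map_poly (scale r)) (\<lambda>b. lprod a b)"
    and sesqui_left: "lprod (d a) b = - pCons 0 (lprod a b)"
    and sesqui_right: "map_poly d (lprod a b) = lprod a (d b) - pCons 0 (lprod a b)"

text \<open>
  The coefficient of \<open>\<lambda>\<^sup>n\<close> in \<open>(a \<^sub>(\<^sub>\<lambda>\<^sub>) b)\<close> is the \<open>n\<close>-product divided by \<open>n!\<close>.
\<close>

definition nprod ::
  "('k::field_char_0 \<Rightarrow> 'c::ab_group_add \<Rightarrow> 'c) \<Rightarrow> ('c \<Rightarrow> 'c \<Rightarrow> 'c poly) \<Rightarrow> nat \<Rightarrow> 'c \<Rightarrow> 'c \<Rightarrow> 'c"
  where "nprod scale lprod n a b = scale (fact n) (coeff (lprod a b) n)"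

text \<open>
  With \<open>S, T \<in> {\<lambda>, \<mu>, \<lambda> + \<mu>, - \<partial> - \<mu>}\<close>, acting on \<open>C[\<lambda>,\<mu>]\<close>:
  \<open>at_op lprod T a b\<close> is \<open>(a \<^sub>(\<^sub>T\<^sub>) b)\<close>;
  \<open>prod_nest_left lprod S T a b c\<close> is \<open>(a \<^sub>(\<^sub>S\<^sub>) b) \<^sub>(\<^sub>T\<^sub>) c\<close>, and
  \<open>prod_right lprod T a S q\<close> is \<open>a \<^sub>(\<^sub>T\<^sub>) q(S)\<close> for \<open>q\<close> in \<open>C[S]\<close>; in both the variable \<open>S\<close>
  (\<open>\<lambda>\<close> or \<open>\<mu>\<close>) is treated as a scalar.
\<close>

definition at_op ::
  "('c::ab_group_add \<Rightarrow> 'c \<Rightarrow> 'c poly) \<Rightarrow> ('c poly poly \<Rightarrow> 'c poly poly) \<Rightarrow> 'c \<Rightarrow> 'c \<Rightarrow> 'c poly poly"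
  where "at_op lprod T a b = op_subst T const2 (lprod a b)"

definition prod_nest_left ::
  "('c::ab_group_add \<Rightarrow> 'c \<Rightarrow> 'c poly) \<Rightarrow> ('c poly poly \<Rightarrow> 'c poly poly) \<Rightarrow>
    ('c poly poly \<Rightarrow> 'c poly poly) \<Rightarrow> 'c \<Rightarrow> 'c \<Rightarrow> 'c \<Rightarrow> 'c poly poly"
  where "prod_nest_left lprod S T a b c = op_subst S (\<lambda>u. at_op lprod T u c) (lprod a b)"

definition prod_right ::
  "('c::ab_group_add \<Rightarrow> 'c \<Rightarrow> 'c poly) \<Rightarrow> ('c poly poly \<Rightarrow> 'c poly poly) \<Rightarrow>
    'c \<Rightarrow> ('c poly poly \<Rightarrow> 'c poly poly) \<Rightarrow> 'c poly \<Rightarrow> 'c poly poly"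
  where "prod_right lprod T a S q = op_subst S (\<lambda>w. at_op lprod T a w) q"

locale commutative_conformal_algebra = conformal_algebra +
  assumes conformal_assoc:
      "prod_right lprod lam_op a mu_op (lprod b c) = prod_nest_left lprod lam_op lam_plus_mu a b c"
    and conformal_comm: "lprod a b = op_subst (neg_d_var d) const1 (lprod b a)"

text \<open>
  In \<open>a \<^sub>(\<^sub>\<lambda>\<^sub>) (c \<^sub>(\<^sub>-\<^sub>\<partial>\<^sub>-\<^sub>\<mu>\<^sub>) b)\<close> the operator \<open>\<partial>\<close> acts on the inner product only, so the
  substitution is performed in \<open>C[\<mu>]\<close>; in \<open>(a \<^sub>(\<^sub>\<lambda>\<^sub>) c) \<^sub>(\<^sub>-\<^sub>\<partial>\<^sub>-\<^sub>\<mu>\<^sub>) b\<close> it acts on the whole product.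
\<close>

locale novikov_conformal_algebra = conformal_algebra +
  assumes conformal_right_symmetric:
      "prod_nest_left lprod lam_op lam_plus_mu a b c - prod_right lprod lam_op a mu_op (lprod b c) =
       prod_nest_left lprod lam_op (neg_d_mu d) a c b -
         prod_right lprod lam_op a mu_op (op_subst (neg_d_var d) const1 (lprod c b))"
    and conformal_left_commutative:
      "prod_right lprod lam_op a mu_op (lprod b c) = prod_right lprod mu_op b lam_op (lprod a c)"

definition conformal_derivation ::
  "('k::field_char_0 \<Rightarrow> 'c::ab_group_add \<Rightarrow> 'c) \<Rightarrow> ('c \<Rightarrow> 'c) \<Rightarrow> ('c \<Rightarrow> 'c \<Rightarrow> 'c poly) \<Rightarrow>
    ('c \<Rightarrow> 'c) \<Rightarrow> bool"
  where "conformal_derivation scale d lprod D \<longleftrightarrow>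
    Vector_Spaces.linear scale scale D \<and>
    (\<forall>a. D (d a) = d (D a)) \<and>
    (\<forall>a b. map_poly D (lprod a b) = lprod (D a) b + lprod a (D b))"

text \<open>The operation of \<open>C\<^sup>(\<^sup>D\<^sup>)\<close>; the space and \<open>\<partial>\<close> are those of \<open>C\<close>.\<close>

definition derived_lprod ::
  "('c::ab_group_add \<Rightarrow> 'c \<Rightarrow> 'c poly) \<Rightarrow> ('c \<Rightarrow> 'c) \<Rightarrow> 'c \<Rightarrow> 'c \<Rightarrow> 'c poly"
  where "derived_lprod lprod D a b = lprod (D a) b"

definition conformal_embedding ::
  "('k::field_char_0 \<Rightarrow> 'b::ab_group_add \<Rightarrow> 'b) \<Rightarrow> ('b \<Rightarrow> 'b) \<Rightarrow> ('b \<Rightarrow> 'b \<Rightarrow> 'b poly) \<Rightarrow>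
    ('k \<Rightarrow> 'c::ab_group_add \<Rightarrow> 'c) \<Rightarrow> ('c \<Rightarrow> 'c) \<Rightarrow> ('c \<Rightarrow> 'c \<Rightarrow> 'c poly) \<Rightarrow> ('b \<Rightarrow> 'c) \<Rightarrow> bool"
  where "conformal_embedding scaleB dB lprodB scaleC dC lprodC \<phi> \<longleftrightarrow>
    Vector_Spaces.linear scaleB scaleC \<phi> \<and> inj \<phi> \<and>
    (\<forall>a. \<phi> (dB a) = dC (\<phi> a)) \<and>
    (\<forall>n a b. \<phi> (nprod scaleB lprodB n a b) = nprod scaleC lprodC n (\<phi> a) (\<phi> b))"

datatype W_gen = X | V nat

text \<open>The free module over \<open>k[\<partial>]\<close> on the generators; \<open>\<partial>\<close> is the variable of \<open>'k poly\<close>.\<close>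

type_synonym 'k W = "W_gen \<Rightarrow>\<^sub>0 'k poly"

definition W_of :: "W_gen \<Rightarrow> 'k::field_char_0 W" where
  "W_of g = Poly_Mapping.single g 1"

definition W_scale :: "'k::field_char_0 \<Rightarrow> 'k W \<Rightarrow> 'k W" where
  "W_scale r = Poly_Mapping.map (smult r)"

definition W_d :: "'k::field_char_0 W \<Rightarrow> 'k W" where
  "W_d = Poly_Mapping.map (pCons 0)"

text \<open>The operators \<open>\<partial> + \<lambda>\<close> and \<open>- \<lambda>\<close> of \<open>W[\<lambda>]\<close>.\<close>

definition W_d_plus_lam :: "'k::field_char_0 W poly \<Rightarrow> 'k W poly" where
  "W_d_plus_lam p = map_poly W_d p + pCons 0 p"

definition W_neg_lam :: "'k::field_char_0 W poly \<Rightarrow> 'k W poly" where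
  "W_neg_lam p = - pCons 0 p"

fun W_table :: "W_gen \<Rightarrow> W_gen \<Rightarrow> 'k::field_char_0 W poly" where
  "W_table (V k) X = (W_d_plus_lam ^^ k) [:W_of (V k):]"
| "W_table _ _ = 0"

text \<open>\<open>W_act T f p\<close> is \<open>f(T) p\<close> for a scalar polynomial \<open>f\<close> and an operator \<open>T\<close> of \<open>W[\<lambda>]\<close>.\<close>

definition W_act ::
  "('k::field_char_0 W poly \<Rightarrow> 'k W poly) \<Rightarrow> 'k poly \<Rightarrow> 'k W poly \<Rightarrow> 'k W poly"
  where "W_act T f p = op_subst T (\<lambda>r. map_poly (W_scale r) p) f"

text \<open>
  Sesquilinearity forces \<open>(f(\<partial>) g \<^sub>(\<^sub>\<lambda>\<^sub>) f'(\<partial>) h) = f(-\<lambda>) f'(\<partial> + \<lambda>) (g \<^sub>(\<^sub>\<lambda>\<^sub>) h)\<close> for generators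
  \<open>g\<close>, \<open>h\<close>.
\<close>

definition W_lprod :: "'k::field_char_0 W \<Rightarrow> 'k W \<Rightarrow> 'k W poly" where
  "W_lprod a b = (\<Sum>g\<in>Poly_Mapping.keys a. \<Sum>h\<in>Poly_Mapping.keys b.
     W_act W_neg_lam (Poly_Mapping.lookup a g)
       (W_act W_d_plus_lam (Poly_Mapping.lookup b h) (W_table g h)))"


text \<open>
  The remaining facts confirm that \<open>W_lprod\<close> is the unique conformal product with the prescribed
  values on generators (\<open>W_conformal\<close>, \<open>W_lprod_generators\<close>, \<open>W_lprod_unique\<close>), and that \<open>W\<close> is
  a Novikov conformal algebra (\<open>W_novikov\<close>).
\<close>


lemma op_subst_upto:
  assumes "additive T" "i 0 = 0" "degree p < N"
  shows "op_subst T i p = (\<Sum>n<N. (T ^^ n) (i (coeff p n)))"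
proof -
  have z: "(T ^^ n) 0 = 0" for n
    by (induct n) (simp_all add: additive.zero[OF assms(1)])
  show ?thesis unfolding op_subst_def
    by (rule sum.mono_neutral_left) (use assms z in \<open>auto simp: coeff_eq_0\<close>)
qed

lemma op_subst_0 [simp]: "i 0 = 0 \<Longrightarrow> op_subst T i 0 = 0"
  by (simp add: op_subst_def)

lemma op_subst_pCons:
  assumes "additive T" "i 0 = 0"
  shows "op_subst T i (pCons c p) = i c + T (op_subst T i p)"
proof -
  have "op_subst T i (pCons c p) = (\<Sum>n<Suc (Suc (degree p)). (T ^^ n) (i (coeff (pCons c p) n)))"
    by (rule op_subst_upto) (use assms in \<open>auto intro: le_imp_less_Suc degree_pCons_le\<close>)
  also have "\<dots> = i c + (\<Sum>n<Suc (degree p). T ((T ^^ n) (i (coeff p n))))"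
    by (subst sum.lessThan_Suc_shift) simp
  also have "\<dots> = i c + T (op_subst T i p)"
    by (simp add: op_subst_upto[where T=T and i=i and p=p and N="Suc (degree p)"] assms additive.sum[OF assms(1)]
        additive.add[OF assms(1)])
  finally show ?thesis .
qed

lemma op_subst_const1: "additive T \<Longrightarrow> i 0 = 0 \<Longrightarrow> op_subst T i [:c:] = i c"
  by (simp add: op_subst_pCons additive.zero)

lemma op_subst_add:
  assumes "additive T" "additive i"
  shows "op_subst T i (p + q) = op_subst T i p + op_subst T i q"
proof (induct p q rule: poly_induct2)
  case 0 then show ?case by (simp add: additive.zero[OF assms(2)])
next
  case (pCons a p b q)
  then show ?case
    by (simp add: op_subst_pCons assms additive.zero[OF assms(2)] additive.add[OF assms(2)]
        additive.add[OF assms(1)] algebra_simps)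
qed

lemma additive_op_subst: "additive T \<Longrightarrow> additive i \<Longrightarrow> additive (op_subst T i)"
  by (simp add: additive_def op_subst_add)

lemma op_subst_hom:
  assumes "additive T" "additive T'" "i 0 = 0" "additive F"
    and "\<And>x. F (T x) = T' (F x)"
  shows "F (op_subst T i p) = op_subst T' (\<lambda>c. F (i c)) p"
  by (induct p) (simp_all add: op_subst_pCons assms additive.zero[OF assms(4)]
        additive.add[OF assms(4)])

lemma op_subst_fun_add:
  assumes "additive T" "i 0 = 0" "j 0 = 0"
  shows "op_subst T (\<lambda>c. i c + j c) p = op_subst T i p + op_subst T j p"
  by (induct p) (simp_all add: op_subst_pCons assms additive.add[OF assms(1)] algebra_simps)

lemma op_subst_map_poly:
  assumes "additive T" "i 0 = 0" "f 0 = 0"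
  shows "op_subst T i (map_poly f p) = op_subst T (\<lambda>c. i (f c)) p"
  by (induct p) (simp_all add: op_subst_pCons assms map_poly_pCons)

lemma op_subst_cong: "(\<And>c. i c = j c) \<Longrightarrow> op_subst T i p = op_subst T j p"
  by (simp add: op_subst_def)

lemma additive_map_poly: "additive f \<Longrightarrow> additive (map_poly f)"
  by (auto simp: additive_def coeff_map_poly additive.zero poly_eq_iff)

lemma additive_pCons: "additive (pCons (0::'a::ab_group_add))"
  by (simp add: additive_def)

lemma additive_uminus: "additive f \<Longrightarrow> additive (\<lambda>x. - f x)"
  by (simp add: additive_def)

lemma additive_plus: "additive f \<Longrightarrow> additive g \<Longrightarrow> additive (\<lambda>x. f x + g x)"
  by (simp add: additive_def algebra_simps)

lemma additive_minus: "additive f \<Longrightarrow> additive g \<Longrightarrow> additive (\<lambda>x. f x - g x)"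
  by (simp add: additive_def algebra_simps)

lemma additive_ops [simp]:
  "additive (lam_op :: 'c::ab_group_add poly poly \<Rightarrow> _)"
  "additive (mu_op :: 'c::ab_group_add poly poly \<Rightarrow> _)"
  "additive (lam_plus_mu :: 'c::ab_group_add poly poly \<Rightarrow> _)"
  "additive (const1 :: 'c \<Rightarrow> _)"
  "additive (const2 :: 'c \<Rightarrow> _)"
  "additive (pCons (0::'c))"
  unfolding lam_op_def mu_op_def lam_plus_mu_def[abs_def] const1_def[abs_def] const2_def[abs_def]
  by (auto intro!: additive_map_poly additive_plus additive_pCons) (simp_all add: additive_def)

lemma additive_neg_d [simp]:
  assumes "additive d"
  shows "additive (neg_d_var d)" "additive (neg_d_mu d)"
  unfolding neg_d_var_def[abs_def] neg_d_mu_def[abs_def] mu_op_def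
  by (auto intro!: additive_map_poly additive_minus additive_uminus additive_pCons assms)

lemma lookup_W_d [simp]: "Poly_Mapping.lookup (W_d a) g = pCons 0 (Poly_Mapping.lookup a g)"
  by (simp add: W_d_def Poly_Mapping.map.rep_eq when_def)

lemma lookup_W_scale [simp]: "Poly_Mapping.lookup (W_scale r a) g = smult r (Poly_Mapping.lookup a g)"
  by (simp add: W_scale_def Poly_Mapping.map.rep_eq when_def)

lemma vector_space_W_scale: "vector_space W_scale"
  by unfold_locales (auto intro!: poly_mapping_eqI simp: lookup_add smult_add_left smult_add_right)

interpretation W: vector_space W_scale by (rule vector_space_W_scale)

lemma vector_space_map_poly: assumes "vector_space s" shows "vector_space (\<lambda>r. map_poly (s r))"
proof -
  interpret vector_space s by fact
  show ?thesis
    by unfold_locales (auto simp: poly_eq_iff coeff_map_poly scale_right_distrib scale_left_distrib)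
qed

interpretation WP: vector_space "\<lambda>r. map_poly (W_scale r)" by (rule vector_space_map_poly[OF vector_space_W_scale])

lemma W_induct [case_names gen add scale d]:
  assumes gen: "\<And>g. P (W_of g)"
    and add: "\<And>a b. P a \<Longrightarrow> P b \<Longrightarrow> P (a + b)"
    and scale: "\<And>r a. P a \<Longrightarrow> P (W_scale r a)"
    and d: "\<And>a. P a \<Longrightarrow> P (W_d a)"
  shows "P a"
proof -
  have z: "P 0" using scale[OF gen, of 0] by simp
  have s: "P (Poly_Mapping.single g p)" for g p
  proof (induct p)
    case 0 then show ?case using z by simp
  next
    case (pCons c p)
    have "Poly_Mapping.single g (pCons c p) = W_scale c (W_of g) + W_d (Poly_Mapping.single g p)"
      by (rule poly_mapping_eqI) (simp add: lookup_add W_of_def lookup_single when_def one_pCons)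
    then show ?case using add[OF scale[OF gen] d[OF pCons(2)]] by simp
  qed
  show ?thesis
  proof (induct a rule: Poly_Mapping.update_induct)
    case const then show ?case using z .
  next
    case (update f g p)
    have "Poly_Mapping.update g p f = f + Poly_Mapping.single g p"
      by (rule poly_mapping_eqI)
        (use update in \<open>auto simp: lookup_update lookup_add lookup_single in_keys_iff when_def\<close>)
    then show ?case using add[OF update(3) s] by simp
  qed
qed

lemma additive_W_d [simp]: "additive W_d"
  by (auto simp: additive_def lookup_add intro!: poly_mapping_eqI)

lemma additive_W_scale [simp]: "additive (W_scale r)"
  by (simp add: additive_def W.scale_right_distrib)

lemma W_d_0 [simp]: "W_d 0 = 0" by (rule additive.zero) simp

lemma additive_W_ops [simp]: "additive W_d_plus_lam" "additive W_neg_lam"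
  unfolding W_d_plus_lam_def[abs_def]
  by (auto intro!: additive_map_poly additive_plus additive_pCons)
    (simp add: additive_def W_neg_lam_def)

lemma W_d_scale: "W_d (W_scale r a) = W_scale r (W_d a)"
  by (auto intro!: poly_mapping_eqI)

lemma map_poly_pCons0: "f 0 = 0 \<Longrightarrow> map_poly f (pCons 0 p) = pCons 0 (map_poly f p)"
  by (simp add: map_poly_pCons)

lemma scale_ops [simp]:
  "map_poly (W_scale r) (W_d_plus_lam p) = W_d_plus_lam (map_poly (W_scale r) p)"
  "map_poly (W_scale r) (W_neg_lam p) = W_neg_lam (map_poly (W_scale r) p)"
  by (auto simp: W_d_plus_lam_def W_neg_lam_def WP.scale_right_distrib map_poly_pCons0
      map_poly_map_poly o_def W_d_scale)

lemma W_neg_plus: "W_neg_lam (W_d_plus_lam p) = W_d_plus_lam (W_neg_lam p)"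
  by (simp add: W_neg_lam_def W_d_plus_lam_def additive.minus[OF additive_map_poly]
     map_poly_pCons0)

lemma W_act_linear:
  assumes "additive T" "\<And>r p. map_poly (W_scale r) (T p) = T (map_poly (W_scale r) p)"
  shows "W_act T 0 p = 0" "W_act T f 0 = 0"
    "W_act T (f + g) p = W_act T f p + W_act T g p"
    "W_act T (smult r f) p = map_poly (W_scale r) (W_act T f p)"
    "W_act T (pCons 0 f) p = T (W_act T f p)"
    "W_act T f (p + q) = W_act T f p + W_act T f q"
    "W_act T f (map_poly (W_scale r) p) = map_poly (W_scale r) (W_act T f p)"
    "additive S \<Longrightarrow> (\<And>r p. map_poly (W_scale r) (S p) = S (map_poly (W_scale r) p)) \<Longrightarrow>
      (\<And>p. S (T p) = T (S p)) \<Longrightarrow> W_act T f (S p) = S (W_act T f p)"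
    "W_act T 1 p = p"
proof -
  note [simp] = assms
  have m: "additive (map_poly (W_scale r))" for r by (auto intro: additive_map_poly)
  have a: "additive (\<lambda>r. map_poly (W_scale r) p)" for p by (simp add: additive_def WP.scale_left_distrib)
  show "W_act T 0 p = 0" by (simp add: W_act_def)
  show "W_act T (f + g) p = W_act T f p + W_act T g p"
    by (simp add: W_act_def op_subst_add a)
  show "W_act T (pCons 0 f) p = T (W_act T f p)" by (simp add: W_act_def op_subst_pCons)
  show "W_act T 1 p = p" by (simp add: W_act_def one_pCons op_subst_const1)
  show sc: "W_act T f (map_poly (W_scale r) p) = map_poly (W_scale r) (W_act T f p)" for f r p
    unfolding W_act_def by (subst op_subst_hom[where T'=T]) (auto intro: m simp: mult.commute)
  show "W_act T f 0 = 0" using sc[where r2=0 and f2=f and p2=p] by simp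
  show "W_act T (smult r f) p = map_poly (W_scale r) (W_act T f p)"
    unfolding W_act_def by (induct f) (simp_all add: op_subst_pCons WP.scale_right_distrib)
  show "W_act T f (p + q) = W_act T f p + W_act T f q"
    by (simp add: W_act_def WP.scale_right_distrib op_subst_fun_add)
  show "W_act T f (S p) = S (W_act T f p)" 
    if "additive S" "(\<And>r p. map_poly (W_scale r) (S p) = S (map_poly (W_scale r) p))" "(\<And>p. S (T p) = T (S p))"
    unfolding W_act_def by (subst op_subst_hom[where T'=T and F=S]) (auto simp: that)
qed

lemmas W_act_neg = W_act_linear[OF additive_W_ops(2) scale_ops(2)]
lemmas W_act_dlam = W_act_linear[OF additive_W_ops(1) scale_ops(1)]

lemma W_lprod_upto:
  assumes "finite A" "finite B" "Poly_Mapping.keys a \<subseteq> A" "Poly_Mapping.keys b \<subseteq> B"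
  shows "W_lprod a b = (\<Sum>g\<in>A. \<Sum>h\<in>B.
     W_act W_neg_lam (Poly_Mapping.lookup a g)
       (W_act W_d_plus_lam (Poly_Mapping.lookup b h) (W_table g h)))"
proof -
  have "W_lprod a b = (\<Sum>g\<in>Poly_Mapping.keys a. \<Sum>h\<in>B.
     W_act W_neg_lam (Poly_Mapping.lookup a g)
       (W_act W_d_plus_lam (Poly_Mapping.lookup b h) (W_table g h)))"
    unfolding W_lprod_def
    by (intro sum.cong refl sum.mono_neutral_left)
      (use assms in \<open>auto simp: in_keys_iff W_act_neg W_act_dlam\<close>)
  also have "\<dots> = (\<Sum>g\<in>A. \<Sum>h\<in>B.
     W_act W_neg_lam (Poly_Mapping.lookup a g)
       (W_act W_d_plus_lam (Poly_Mapping.lookup b h) (W_table g h)))"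
    by (intro sum.mono_neutral_left)
      (use assms in \<open>auto simp: in_keys_iff W_act_neg W_act_dlam\<close>)
  finally show ?thesis .
qed

lemma W_lprod_gen: "W_lprod (W_of g) (W_of h) = W_table g h"
  by (simp add: W_lprod_def W_of_def W_act_neg W_act_dlam)

lemma W_lprod_add_left: "W_lprod (a + a') b = W_lprod a b + W_lprod a' b"
proof -
  let ?A = "Poly_Mapping.keys a \<union> Poly_Mapping.keys a' \<union> Poly_Mapping.keys (a + a')"
  show ?thesis
    by (subst (1 2 3) W_lprod_upto[where A="?A" and B="Poly_Mapping.keys b"])
      (auto simp: lookup_add W_act_neg sum.distrib)
qed

lemma W_lprod_add_right: "W_lprod b (a + a') = W_lprod b a + W_lprod b a'"
proof -
  let ?A = "Poly_Mapping.keys a \<union> Poly_Mapping.keys a' \<union> Poly_Mapping.keys (a + a')"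
  show ?thesis
    by (subst (1 2 3) W_lprod_upto[where B="?A" and A="Poly_Mapping.keys b"])
      (auto simp: lookup_add W_act_neg W_act_dlam sum.distrib)
qed

lemma W_lprod_scale_left: "W_lprod (W_scale r a) b = map_poly (W_scale r) (W_lprod a b)"
proof -
  let ?A = "Poly_Mapping.keys a \<union> Poly_Mapping.keys (W_scale r a)"
  show ?thesis
    by (subst (1 2) W_lprod_upto[where A="?A" and B="Poly_Mapping.keys b"])
      (auto simp: lookup_add W_act_neg WP.scale_sum_right)
qed

lemma W_lprod_scale_right: "W_lprod b (W_scale r a) = map_poly (W_scale r) (W_lprod b a)"
proof -
  let ?A = "Poly_Mapping.keys a \<union> Poly_Mapping.keys (W_scale r a)"
  show ?thesis
    by (subst (1 2) W_lprod_upto[where B="?A" and A="Poly_Mapping.keys b"])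
      (auto simp: lookup_add W_act_neg W_act_dlam WP.scale_sum_right)
qed

lemma W_lprod_d_left: "W_lprod (W_d a) b = W_neg_lam (W_lprod a b)"
proof -
  let ?A = "Poly_Mapping.keys a \<union> Poly_Mapping.keys (W_d a)"
  show ?thesis
    by (subst (1 2) W_lprod_upto[where A="?A" and B="Poly_Mapping.keys b"])
      (auto simp: lookup_add W_act_neg additive.sum[OF additive_W_ops(2)])
qed

lemma W_lprod_d_right: "W_lprod b (W_d a) = W_d_plus_lam (W_lprod b a)"
proof -
  let ?A = "Poly_Mapping.keys a \<union> Poly_Mapping.keys (W_d a)"
  show ?thesis
    by (subst (1 2) W_lprod_upto[where B="?A" and A="Poly_Mapping.keys b"])
      (auto simp: lookup_add W_act_neg W_act_dlam W_neg_plus additive.sum[OF additive_W_ops(1)])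
qed

lemma W_conformal: "conformal_algebra W_scale W_d W_lprod"
  by unfold_locales
    (auto simp: W_d_scale additive.add[OF additive_W_d]
      W_lprod_add_left W_lprod_add_right W_lprod_scale_left W_lprod_scale_right
      W_lprod_d_left W_lprod_d_right W_neg_lam_def W_d_plus_lam_def)

lemma additive_W_lprod [simp]: "additive (\<lambda>a. W_lprod a b)" "additive (W_lprod a)"
  by (simp_all add: additive_def W_lprod_add_left W_lprod_add_right)


lemma W_const2_ops:
  "lam_op (mu_op p) = mu_op (lam_op (p :: 'c::ab_group_add poly poly))"
  by (simp add: lam_op_def mu_op_def map_poly_pCons)

definition d_op2 where "d_op2 d = map_poly (map_poly (d :: 'c::ab_group_add \<Rightarrow> 'c))"

lemma d_op2_ops:
  assumes "additive d"
  shows "additive (d_op2 d)" "d_op2 d (lam_op p) = lam_op (d_op2 d p)" "d_op2 d (mu_op p) = mu_op (d_op2 d p)"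
    "d_op2 d (const2 c) = const2 (d c)" "neg_d_mu d p = - d_op2 d p - mu_op p"
  using assms
  by (auto simp: d_op2_def lam_op_def mu_op_def const2_def neg_d_mu_def map_poly_pCons
     map_poly_map_poly o_def additive.zero
     intro!: additive_map_poly map_poly_cong)

lemma at_op_W:
  fixes T :: "'k::field_char_0 W poly poly \<Rightarrow> 'k W poly poly"
  assumes T: "additive T" and dT: "\<And>p. d_op2 W_d (T p) = T (d_op2 W_d p)"
    and sT: "\<And>r p. map_poly (map_poly (W_scale r)) (T p) = T (map_poly (map_poly (W_scale r)) p)"
  shows "at_op W_lprod T (u + v) c = at_op W_lprod T u c + at_op W_lprod T v c"
    "at_op W_lprod T u (c + e) = at_op W_lprod T u c + at_op W_lprod T u e"
    "at_op W_lprod T (W_scale r u) c = map_poly (map_poly (W_scale r)) (at_op W_lprod T u c)"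
    "at_op W_lprod T u (W_scale r c) = map_poly (map_poly (W_scale r)) (at_op W_lprod T u c)"
    "at_op W_lprod T (W_d u) c = - T (at_op W_lprod T u c)"
    "at_op W_lprod T u (W_d c) = d_op2 W_d (at_op W_lprod T u c) + T (at_op W_lprod T u c)"
    "op_subst T const2 (W_d_plus_lam p) = d_op2 W_d (op_subst T const2 p) + T (op_subst T const2 p)"
proof -
  have z[simp]: "const2 0 = (0 :: 'k W poly poly)" by (simp add: const2_def)
  note [simp] = T dT sT additive.minus[OF T] d_op2_ops[OF additive_W_d]
  have a: "additive (\<lambda>p. op_subst T const2 p)" by (simp add: additive_op_subst)
  have m: "op_subst T const2 (map_poly (W_scale r) p) =
     map_poly (map_poly (W_scale r)) (op_subst T const2 p)" for r p
    by (subst op_subst_hom[where T'=T])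
      (auto intro!: additive_map_poly op_subst_cong simp: op_subst_map_poly const2_def map_poly_pCons)
  have dd: "op_subst T const2 (map_poly W_d p) = d_op2 W_d (op_subst T const2 p)" for p
    by (subst op_subst_hom[where T'=T])
      (auto intro!: additive_map_poly op_subst_cong simp: op_subst_map_poly)
  have p: "op_subst T const2 (pCons 0 q) = T (op_subst T const2 q)" for q :: "'k W poly"
    by (simp add: op_subst_pCons)
  show "at_op W_lprod T (u + v) c = at_op W_lprod T u c + at_op W_lprod T v c"
    "at_op W_lprod T u (c + e) = at_op W_lprod T u c + at_op W_lprod T u e"
    "at_op W_lprod T (W_scale r u) c = map_poly (map_poly (W_scale r)) (at_op W_lprod T u c)"
    "at_op W_lprod T u (W_scale r c) = map_poly (map_poly (W_scale r)) (at_op W_lprod T u c)"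
    "at_op W_lprod T (W_d u) c = - T (at_op W_lprod T u c)"
    "at_op W_lprod T u (W_d c) = d_op2 W_d (at_op W_lprod T u c) + T (at_op W_lprod T u c)"
    "op_subst T const2 (W_d_plus_lam p) = d_op2 W_d (op_subst T const2 p) + T (op_subst T const2 p)"
    by (simp_all add: at_op_def W_lprod_add_left W_lprod_add_right W_lprod_scale_left
      W_lprod_scale_right W_lprod_d_left W_lprod_d_right W_d_plus_lam_def W_neg_lam_def
      additive.add[OF a] additive.minus[OF a] m dd p)
qed

lemma nest_W:
  fixes T :: "'k::field_char_0 W poly poly \<Rightarrow> 'k W poly poly"
  assumes T: "additive T" and dT: "\<And>p. d_op2 W_d (T p) = T (d_op2 W_d p)"
    and sT: "\<And>r p. map_poly (map_poly (W_scale r)) (T p) = T (map_poly (map_poly (W_scale r)) p)"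
    and lT: "\<And>p. lam_op (T p) = T (lam_op p)"
  defines "N \<equiv> prod_nest_left W_lprod lam_op T"
  shows "N (a + a') b c = N a b c + N a' b c"
    "N a (b + b') c = N a b c + N a b' c"
    "N a b (c + c') = N a b c + N a b c'"
    "N (W_scale r a) b c = map_poly (map_poly (W_scale r)) (N a b c)"
    "N a (W_scale r b) c = map_poly (map_poly (W_scale r)) (N a b c)"
    "N a b (W_scale r c) = map_poly (map_poly (W_scale r)) (N a b c)"
    "N (W_d a) b c = - lam_op (N a b c)"
    "N a (W_d b) c = lam_op (N a b c) - T (N a b c)"
    "N a b (W_d c) = d_op2 W_d (N a b c) + T (N a b c)"
    "op_subst lam_op (\<lambda>u. at_op W_lprod T u c) (W_d_plus_lam p) =
      lam_op (op_subst lam_op (\<lambda>u. at_op W_lprod T u c) p) - T (op_subst lam_op (\<lambda>u. at_op W_lprod T u c) p)"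
proof -
  note at = at_op_W[OF T dT sT]
  have ad[simp]: "additive (\<lambda>u. at_op W_lprod T u c)" for c by (simp add: additive_def at)
  have z[simp]: "at_op W_lprod T 0 c = 0" for c using additive.zero[OF ad] .
  define G where "G c = op_subst lam_op (\<lambda>u. at_op W_lprod T u c)" for c
  have N: "N a b c = G c (W_lprod a b)" for a b c by (simp add: N_def prod_nest_left_def G_def)
  have aG: "additive (G c)" for c unfolding G_def by (simp add: additive_op_subst)
  note [simp] = T dT sT lT d_op2_ops[OF additive_W_d]
  have sl: "map_poly (map_poly (W_scale r)) (lam_op p) = lam_op (map_poly (map_poly (W_scale r)) p)"
    for r :: 'k and p
    by (simp add: lam_op_def map_poly_map_poly o_def map_poly_pCons0)
  have G1: "G c (map_poly (W_scale r) p) = map_poly (map_poly (W_scale r)) (G c p)" for c r p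
    unfolding G_def by (subst op_subst_hom[where T'=lam_op])
      (auto intro!: additive_map_poly op_subst_cong simp: op_subst_map_poly at sl)
  have G2: "G (W_scale r c) p = map_poly (map_poly (W_scale r)) (G c p)" for c r p
    unfolding G_def by (subst op_subst_hom[where T'=lam_op])
      (auto intro!: additive_map_poly op_subst_cong simp: op_subst_map_poly at sl)
  have G3: "G c (pCons 0 p) = lam_op (G c p)" for c p
    unfolding G_def by (simp add: op_subst_pCons)
  have mT: "additive (\<lambda>x. - T x)" using T by (simp add: additive_def)
  have G4: "G c (map_poly W_d p) = - T (G c p)" for c p
    unfolding G_def
    by (subst op_subst_hom[where T'=lam_op and F="\<lambda>x. - T x"])
      (auto intro!: op_subst_cong mT simp: op_subst_map_poly at additive.minus[OF additive_ops(1)])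
  have aF: "additive (\<lambda>x. d_op2 W_d x + T x)" by (intro additive_plus) auto
  have G5: "G (W_d c) p = d_op2 W_d (G c p) + T (G c p)" for c p
    unfolding G_def
    by (subst op_subst_hom[where T'=lam_op and F="\<lambda>x. d_op2 W_d x + T x"])
      (auto intro!: op_subst_cong aF simp: op_subst_map_poly at additive.add[OF additive_ops(1)])
  have G6: "G (c + c') p = G c p + G c' p" for c c' p
    unfolding G_def by (simp add: at op_subst_fun_add)
  show "N (a + a') b c = N a b c + N a' b c"
    "N a (b + b') c = N a b c + N a b' c"
    "N a b (c + c') = N a b c + N a b c'"
    "N (W_scale r a) b c = map_poly (map_poly (W_scale r)) (N a b c)"
    "N a (W_scale r b) c = map_poly (map_poly (W_scale r)) (N a b c)"
    "N a b (W_scale r c) = map_poly (map_poly (W_scale r)) (N a b c)"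
    "N (W_d a) b c = - lam_op (N a b c)"
    "N a (W_d b) c = lam_op (N a b c) - T (N a b c)"
    "N a b (W_d c) = d_op2 W_d (N a b c) + T (N a b c)"
    "op_subst lam_op (\<lambda>u. at_op W_lprod T u c) (W_d_plus_lam p) =
      lam_op (op_subst lam_op (\<lambda>u. at_op W_lprod T u c) p) - T (op_subst lam_op (\<lambda>u. at_op W_lprod T u c) p)"
    unfolding N G_def[symmetric]
    by (simp_all add: G1 G2 G3 G4 G5 G6 additive.add[OF aG] additive.minus[OF aG] additive.minus[OF additive_ops(1)]
      W_lprod_add_left W_lprod_add_right W_lprod_scale_left
      W_lprod_scale_right W_lprod_d_left W_lprod_d_right W_d_plus_lam_def W_neg_lam_def)
qed

lemma W_lprod_vspan: "Poly_Mapping.lookup b X = 0 \<Longrightarrow> W_lprod a b = 0"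
proof -
  assume b: "Poly_Mapping.lookup b X = 0"
  have "W_act W_neg_lam (Poly_Mapping.lookup a g)
       (W_act W_d_plus_lam (Poly_Mapping.lookup b h) (W_table g h)) = 0" for g h
    using b by (cases g; cases h) (simp_all add: W_act_dlam W_act_neg)
  then show ?thesis by (simp add: W_lprod_def)
qed

definition W_vpoly where "W_vpoly p \<longleftrightarrow> (\<forall>n. Poly_Mapping.lookup (coeff p n) X = 0)"

lemma W_vpoly_ops: "W_vpoly 0" "W_vpoly p \<Longrightarrow> W_vpoly q \<Longrightarrow> W_vpoly (p + q)"
  "W_vpoly p \<Longrightarrow> W_vpoly (- p)"
  "W_vpoly p \<Longrightarrow> W_vpoly (pCons 0 p)" "W_vpoly p \<Longrightarrow> W_vpoly (map_poly W_d p)"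
  "W_vpoly p \<Longrightarrow> W_vpoly (map_poly (W_scale r) p)"
  by (auto simp: W_vpoly_def lookup_add coeff_map_poly coeff_pCons split: nat.split)

lemma W_vpoly_lprod: "W_vpoly (W_lprod a b)"
proof (induct a rule: W_induct)
  case (gen g)
  show ?case
  proof (induct b rule: W_induct)
    case (gen h)
    have k: "W_vpoly ((W_d_plus_lam ^^ j) [:W_of (V k):])" for k j
    proof (induct j)
      case 0 then show ?case
        by (auto simp: W_vpoly_def W_of_def lookup_single coeff_pCons split: nat.split)
    next
      case (Suc j) then show ?case by (auto simp: W_d_plus_lam_def intro!: W_vpoly_ops)
    qed
    show ?case unfolding W_lprod_gen by (cases g; cases h) (auto simp: k W_vpoly_ops)
  qed (auto simp: W_lprod_add_right W_lprod_scale_right W_lprod_d_right W_d_plus_lam_def W_vpoly_ops)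
qed (auto simp: W_lprod_add_left W_lprod_scale_left W_lprod_d_left W_neg_lam_def W_vpoly_ops)

lemma prod_right_W_vpoly: "W_vpoly p \<Longrightarrow> additive S \<Longrightarrow> additive T \<Longrightarrow> prod_right W_lprod T a S p = 0"
proof -
  assume *: "W_vpoly p" "additive S" "additive T"
  have z: "(S ^^ n) 0 = 0" for n by (induct n) (simp_all add: additive.zero[OF *(2)])
  have "at_op W_lprod T a (coeff p n) = 0" for n
    using * W_lprod_vspan[of "coeff p n" a]
    by (simp add: at_op_def W_vpoly_def const2_def)
  then show ?thesis by (simp add: prod_right_def op_subst_def z)
qed

lemma W_vpoly_neg:
  fixes p :: "'k::field_char_0 W poly"
  shows "W_vpoly p \<Longrightarrow> W_vpoly (op_subst (neg_d_var W_d) const1 p)"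
proof -
  assume p: "W_vpoly p"
  have s: "W_vpoly (sum f A)" if "\<And>x. x \<in> A \<Longrightarrow> W_vpoly (f x)" "finite A" for f :: "nat \<Rightarrow> 'k W poly" and A :: "nat set"
    using that(2,1) by (induct A rule: finite_induct) (simp_all add: W_vpoly_ops)
  have "W_vpoly ((neg_d_var W_d ^^ n) (const1 (coeff p m)))" for n m
  proof (induct n)
    case 0 show ?case using p by (auto simp: const1_def W_vpoly_def coeff_pCons split: nat.split)
  next
    case (Suc n)
    then show ?case
      by (auto simp: neg_d_var_def diff_conv_add_uminus simp del: add_uminus_conv_diff intro!: W_vpoly_ops)
  qed
  then show ?thesis unfolding op_subst_def by (intro s) auto
qed


lemma T_ops:
  fixes p :: "'k::field_char_0 W poly poly"
  shows "d_op2 W_d (lam_plus_mu p) = lam_plus_mu (d_op2 W_d p)"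
    "map_poly (map_poly (W_scale r)) (lam_plus_mu p) = lam_plus_mu (map_poly (map_poly (W_scale r)) p)"
    "lam_op (lam_plus_mu p) = lam_plus_mu (lam_op p)"
    "d_op2 W_d (neg_d_mu W_d p) = neg_d_mu W_d (d_op2 W_d p)"
    "map_poly (map_poly (W_scale r)) (neg_d_mu W_d p) = neg_d_mu W_d (map_poly (map_poly (W_scale r)) p)"
    "lam_op (neg_d_mu W_d p) = neg_d_mu W_d (lam_op p)"
proof -
  have sl: "map_poly (map_poly (W_scale r)) (lam_op p) = lam_op (map_poly (map_poly (W_scale r)) p)"
    and sm: "map_poly (map_poly (W_scale r)) (mu_op p) = mu_op (map_poly (map_poly (W_scale r)) p)"
    and sd: "map_poly (map_poly (W_scale r)) (d_op2 W_d p) = d_op2 W_d (map_poly (map_poly (W_scale r)) p)"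
    for r :: 'k and p
    by (simp_all add: lam_op_def mu_op_def d_op2_def map_poly_map_poly o_def map_poly_pCons0 W_d_scale)
  have a: "additive (map_poly (map_poly (W_scale r)))" for r :: 'k
    by (auto intro!: additive_map_poly)
  note d = d_op2_ops[OF additive_W_d]
  note [simp] = additive.add[OF d(1)] additive.minus[OF d(1)] additive.diff[OF d(1)] d(2-5) sl sm sd
    additive.add[OF a] additive.minus[OF a] additive.diff[OF a] W_const2_ops
    additive.add[OF additive_ops(1)] additive.minus[OF additive_ops(1)] additive.diff[OF additive_ops(1)]
  show "d_op2 W_d (lam_plus_mu p) = lam_plus_mu (d_op2 W_d p)"
    "map_poly (map_poly (W_scale r)) (lam_plus_mu p) = lam_plus_mu (map_poly (map_poly (W_scale r)) p)"
    "lam_op (lam_plus_mu p) = lam_plus_mu (lam_op p)"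
    "d_op2 W_d (neg_d_mu W_d p) = neg_d_mu W_d (d_op2 W_d p)"
    "map_poly (map_poly (W_scale r)) (neg_d_mu W_d p) = neg_d_mu W_d (map_poly (map_poly (W_scale r)) p)"
    "lam_op (neg_d_mu W_d p) = neg_d_mu W_d (lam_op p)"
    by (simp_all add: lam_plus_mu_def)
qed

lemmas W_nest_plus = nest_W[OF additive_ops(3) T_ops(1-3)]
lemmas W_nest_neg = nest_W[OF additive_neg_d(2)[OF additive_W_d] T_ops(4-6)]
lemmas W_at_plus = at_op_W[OF additive_ops(3) T_ops(1-2)]
lemmas W_at_neg = at_op_W[OF additive_neg_d(2)[OF additive_W_d] T_ops(4-5)]

lemma op_subst_zero: "additive S \<Longrightarrow> (\<And>c. i c = 0) \<Longrightarrow> op_subst S i p = 0"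
  by (induct p) (simp_all add: op_subst_pCons additive.zero)

lemma at_op_vspan: "Poly_Mapping.lookup b X = 0 \<Longrightarrow> additive T \<Longrightarrow> at_op W_lprod T a b = 0"
  by (simp add: at_op_def W_lprod_vspan const2_def)

lemma nest_pow:
  fixes T :: "'k::field_char_0 W poly poly \<Rightarrow> 'k W poly poly"
  assumes "additive T"
    and "\<And>p. op_subst lam_op (\<lambda>u. at_op W_lprod T u (W_of X)) (W_d_plus_lam p) =
       F (op_subst lam_op (\<lambda>u. at_op W_lprod T u (W_of X)) p)"
    and "\<And>p. op_subst T const2 (W_d_plus_lam p) = H (op_subst T const2 p)"
  shows "prod_nest_left W_lprod lam_op T (W_of (V k)) (W_of X) (W_of X) =
     (F ^^ k) ((H ^^ k) (const2 (W_of (V k))))"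
proof -
  have z: "const2 0 = (0 :: 'k W poly poly)" by (simp add: const2_def)
  have 1: "op_subst lam_op (\<lambda>u. at_op W_lprod T u (W_of X)) ((W_d_plus_lam ^^ j) p) =
     (F ^^ j) (op_subst lam_op (\<lambda>u. at_op W_lprod T u (W_of X)) p)" for j p
    by (induct j) (simp_all add: assms)
  have 2: "op_subst T const2 ((W_d_plus_lam ^^ j) p) = (H ^^ j) (op_subst T const2 p)" for j p
    by (induct j) (simp_all add: assms)
  have 0: "at_op W_lprod T 0 (W_of X) = 0"
    by (simp add: at_op_def z additive.zero[OF additive_W_lprod(1)])
  show ?thesis
    by (simp add: prod_nest_left_def W_lprod_gen 1 op_subst_const1 0 z)
      (simp add: at_op_def W_lprod_gen 2 op_subst_const1 assms(1) z)
qed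

lemma funpow_commute: "(\<And>x. f (g x) = g (f x)) \<Longrightarrow> (f ^^ k) ((g ^^ l) x) = (g ^^ l) ((f ^^ k) x)"
  for f g :: "'a \<Rightarrow> 'a"
proof -
  assume *: "\<And>x. f (g x) = g (f x)"
  have "f ((g ^^ l) x) = (g ^^ l) (f x)" for l x by (induct l) (simp_all add: *)
  then show ?thesis by (induct k) simp_all
qed

lemma W_right_symm:
  fixes a b c :: "'k::field_char_0 W"
  shows "prod_nest_left W_lprod lam_op lam_plus_mu a b c =
   prod_nest_left W_lprod lam_op (neg_d_mu W_d) a c b"
proof (induct a rule: W_induct)
  case (gen g)
  show ?case
  proof (induct b rule: W_induct)
    case (gen h)
    show ?case
    proof (induct c rule: W_induct)
      case (gen m)
      have z: "W_table g h = (0 :: 'k W poly) \<Longrightarrow> prod_nest_left W_lprod lam_op T (W_of g) (W_of h) c = 0"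
        for T :: "'k W poly poly \<Rightarrow> 'k W poly poly" and g h c
        by (simp add: prod_nest_left_def W_lprod_gen at_op_def op_subst_def const2_def
           additive.zero[OF additive_W_lprod(1)])
      have z2: "additive T \<Longrightarrow> prod_nest_left W_lprod lam_op T a b (W_of (V j)) = 0"
        for T :: "'k W poly poly \<Rightarrow> 'k W poly poly" and a b j
        by (simp add: prod_nest_left_def op_subst_zero at_op_vspan W_of_def lookup_single)
      show ?case
      proof (cases "g = X \<or> h \<noteq> X \<or> m \<noteq> X")
        case True
        have "prod_nest_left W_lprod lam_op lam_plus_mu (W_of g) (W_of h) (W_of m) = (0 :: 'k W poly poly)"
          using True z z2[OF additive_ops(3)] by (cases g; cases h; cases m) auto
        moreover have "prod_nest_left W_lprod lam_op (neg_d_mu W_d) (W_of g) (W_of m) (W_of h) = (0 :: 'k W poly poly)"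
          using True z z2[OF additive_neg_d(2)[OF additive_W_d]] by (cases g; cases h; cases m) auto
        ultimately show ?thesis by simp
      next
        case False
        then obtain k where g: "g = V k" "h = X" "m = X" by (cases g) auto
        let ?M = "\<lambda>x :: 'k W poly poly. - mu_op x"
        let ?D = "\<lambda>x :: 'k W poly poly. d_op2 W_d x + lam_op x + mu_op x"
        have E: "lam_op x - lam_plus_mu x = ?M x" "d_op2 W_d x + lam_plus_mu x = ?D x" for x
          by (simp_all add: lam_plus_mu_def)
        have E2: "lam_op x - neg_d_mu W_d x = ?D x" "d_op2 W_d x + neg_d_mu W_d x = ?M x" for x
          by (simp_all add: d_op2_ops)
        have 1: "prod_nest_left W_lprod lam_op lam_plus_mu (W_of g) (W_of h) (W_of m) =
          (?M ^^ k) ((?D ^^ k) (const2 (W_of (V k))))"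
          unfolding g by (rule nest_pow) (simp_all only: W_nest_plus W_at_plus additive_ops E)
        have 2: "prod_nest_left W_lprod lam_op (neg_d_mu W_d) (W_of g) (W_of m) (W_of h) =
          (?D ^^ k) ((?M ^^ k) (const2 (W_of (V k))))"
          unfolding g by (rule nest_pow) (simp_all only: W_nest_neg W_at_neg additive_neg_d additive_W_d E2)
        note d = d_op2_ops[OF additive_W_d]
        show ?thesis unfolding 1 2
          by (rule funpow_commute) (simp add: additive.minus[OF additive_ops(1)]
             additive.minus[OF additive_ops(2)] additive.add[OF additive_ops(2)] d
             additive.minus[OF d(1)] W_const2_ops algebra_simps)
      qed
    qed (simp_all add: W_nest_plus W_nest_neg, simp_all add: lam_plus_mu_def d_op2_ops algebra_simps)
  qed (simp_all add: W_nest_plus W_nest_neg, simp_all add: lam_plus_mu_def d_op2_ops algebra_simps)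
qed (simp_all add: W_nest_plus W_nest_neg)

lemma W_novikov: "novikov_conformal_algebra W_scale W_d W_lprod"
proof -
  interpret conformal_algebra W_scale W_d W_lprod by (rule W_conformal)
  show ?thesis
    by unfold_locales
     (simp_all add: prod_right_W_vpoly W_vpoly_lprod W_vpoly_neg W_right_symm)
qed


lemma W_lprod_unique:
  assumes "conformal_algebra W_scale W_d L"
    and gens: "\<And>g h. L (W_of g) (W_of h) = W_table g h"
  shows "L = (W_lprod :: 'k::field_char_0 W \<Rightarrow> 'k W \<Rightarrow> 'k W poly)"
proof -
  interpret L: conformal_algebra W_scale W_d L by fact
  have l: "L (a + a') b = L a b + L a' b" "L (W_scale r a) b = map_poly (W_scale r) (L a b)"
    for a a' b r
    using L.linear_lprod_left[of b]
    by (auto simp: Vector_Spaces.linear_def module_hom_def module_hom_axioms_def)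
  have r: "L b (a + a') = L b a + L b a'" "L b (W_scale r a) = map_poly (W_scale r) (L b a)"
    for a a' b r
    using L.linear_lprod_right[of b]
    by (auto simp: Vector_Spaces.linear_def module_hom_def module_hom_axioms_def)
  have dr: "L a (W_d b) = W_d_plus_lam (L a b)" for a b
    using L.sesqui_right[of a b] by (simp add: W_d_plus_lam_def)
  have "L a b = W_lprod a b" for a b
  proof (induct a rule: W_induct)
    case (gen g)
    show ?case
      by (induct b rule: W_induct)
        (simp_all add: gens W_lprod_gen r dr W_lprod_add_right W_lprod_scale_right W_lprod_d_right)
  qed (simp_all add: l L.sesqui_left W_lprod_add_left W_lprod_scale_left W_lprod_d_left W_neg_lam_def)
  then show ?thesis by blast
qed

lemma W_lprod_generators:
  "W_lprod (W_of (V k)) (W_of X) = (W_d_plus_lam ^^ k) [:W_of (V k):]"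
  "W_lprod (W_of X) (W_of X) = 0"
  "W_lprod (W_of X) (W_of (V k)) = 0"
  "W_lprod (W_of (V k)) (W_of (V p)) = 0"
  by (simp_all add: W_lprod_gen)

end

theory Submission
  imports Defs
begin

text \<open>
  The proof is a degree count in \<open>\<lambda>\<close>. Write \<open>x\<close> and \<open>v\<^sub>k\<close> also for the images of the generators
  in \<open>C\<close>, so that \<open>Dx \<^sub>(\<^sub>\<lambda>\<^sub>) v\<^sub>k = 0\<close> and \<open>Dv\<^sub>k \<^sub>(\<^sub>\<lambda>\<^sub>) x = (\<partial> + \<lambda>)\<^sup>k v\<^sub>k\<close>. Since commutativity
  substitutes \<open>- \<partial> - \<lambda>\<close> for \<open>\<lambda>\<close>, it turns \<open>\<partial> + \<lambda>\<close> into \<open>- \<lambda>\<close>, and the second relation becomes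
  \<open>x \<^sub>(\<^sub>\<lambda>\<^sub>) Dv\<^sub>k = (-\<lambda>)\<^sup>k v\<^sub>k\<close> (\<open>lprod_commuted_power\<close>).

  Associativity at \<open>\<mu> = -\<lambda>\<close> reads \<open>a \<^sub>(\<^sub>\<lambda>\<^sub>) (b \<^sub>(\<^sub>-\<^sub>\<lambda>\<^sub>) c) = (a \<^sub>(\<^sub>\<lambda>\<^sub>) b) \<^sub>(\<^sub>0\<^sub>) c\<close>, and the right-hand side
  has degree at most that of \<open>a \<^sub>(\<^sub>\<lambda>\<^sub>) b\<close>, whatever \<open>c\<close> is (\<open>degree_lprod_antidiagonal\<close>). With
  \<open>a = b = x\<close> and \<open>c = Dv\<^sub>k\<close>, the left-hand side is \<open>\<lambda>\<^sup>k (x \<^sub>(\<^sub>\<lambda>\<^sub>) v\<^sub>k)\<close>, which \<open>D\<close> sends to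
  \<open>\<lambda>\<^sup>k (x \<^sub>(\<^sub>\<lambda>\<^sub>) Dv\<^sub>k) = \<lambda>\<^sup>k (-\<lambda>)\<^sup>k v\<^sub>k\<close>. Hence \<open>2k\<close> is at most the degree of \<open>x \<^sub>(\<^sub>\<lambda>\<^sub>) x\<close>
  for every \<open>k\<close> (\<open>degree_lprod_self_ge\<close>), which is impossible: one locality bound for the pair
  \<open>x, x\<close> cannot serve infinitely many \<open>v\<^sub>k\<close>.
\<close>

definition neg_lam :: "'c::ab_group_add poly \<Rightarrow> 'c poly" where
  "neg_lam p = - pCons 0 p"

lemma additive_neg_lam: "additive neg_lam"
  by (simp add: additive_def neg_lam_def)

lemma degree_neg_lam_funpow: "p \<noteq> 0 \<Longrightarrow> degree ((neg_lam ^^ k) p) = degree p + k"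
proof -
  assume "p \<noteq> 0"
  then have "(neg_lam ^^ k) p \<noteq> 0 \<and> degree ((neg_lam ^^ k) p) = degree p + k"
    by (induct k) (simp_all add: neg_lam_def)
  then show ?thesis ..
qed

lemma degree_shift_funpow:
  "p \<noteq> 0 \<Longrightarrow> degree ((pCons (0::'c::ab_group_add) ^^ k) p) = degree p + k"
proof -
  assume "p \<noteq> 0"
  then have "(pCons 0 ^^ k) p \<noteq> 0 \<and> degree ((pCons 0 ^^ k) p) = degree p + k"
    by (induct k) simp_all
  then show ?thesis ..
qed

lemma map_poly_shift_funpow:
  "f 0 = 0 \<Longrightarrow> map_poly f ((pCons 0 ^^ k) p) = (pCons 0 ^^ k) (map_poly f p)"
  by (induct k) (simp_all add: map_poly_pCons0)

text \<open>
  The two signs cancel: substituting \<open>-\<lambda>\<close> for the variable turns the factor \<open>(-\<lambda>)\<^sup>k\<close> into \<open>\<lambda>\<^sup>k\<close>.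
\<close>

lemma op_subst_neg_lam_funpow:
  assumes "additive i"
  shows "op_subst neg_lam i ((neg_lam ^^ k) p) = (pCons 0 ^^ k) (op_subst neg_lam i p)"
proof (induct k)
  case (Suc k)
  have "op_subst neg_lam i (neg_lam q) = pCons 0 (op_subst neg_lam i q)" for q
    by (simp add: neg_lam_def[of q] additive.minus[OF additive_op_subst] additive_neg_lam assms
        op_subst_pCons additive.zero[OF assms])
      (simp add: neg_lam_def)
  with Suc show ?case by simp
qed simp

text \<open>The restriction of a polynomial in \<open>\<lambda>, \<mu>\<close> to the line \<open>\<mu> = -\<lambda>\<close>.\<close>

definition antidiagonal :: "'c::ab_group_add poly poly \<Rightarrow> 'c poly" where
  "antidiagonal = op_subst neg_lam (\<lambda>p. p)"

lemma additive_antidiagonal: "additive antidiagonal"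
  unfolding antidiagonal_def
  by (rule additive_op_subst[OF additive_neg_lam]) (simp add: additive_def)

lemma antidiagonal_ops:
  "antidiagonal (lam_op p) = pCons 0 (antidiagonal p)"
  "antidiagonal (mu_op p) = neg_lam (antidiagonal p)"
  "antidiagonal (lam_plus_mu p) = 0"
  "antidiagonal (const2 c) = const1 c"
proof -
  show mu: "antidiagonal (mu_op p) = neg_lam (antidiagonal p)" for p :: "'a poly poly"
    by (simp add: antidiagonal_def mu_op_def op_subst_pCons additive_neg_lam)
  have "antidiagonal (lam_op p) = op_subst neg_lam (pCons 0) p"
    by (simp add: antidiagonal_def lam_op_def op_subst_map_poly additive_neg_lam)
  also have "\<dots> = pCons 0 (antidiagonal p)"
    unfolding antidiagonal_def
    by (rule op_subst_hom[symmetric]) (simp_all add: additive_neg_lam, simp add: neg_lam_def)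
  finally show lam: "antidiagonal (lam_op p) = pCons 0 (antidiagonal p)" .
  show "antidiagonal (lam_plus_mu p) = 0"
    by (simp add: lam_plus_mu_def additive.add[OF additive_antidiagonal] lam mu neg_lam_def)
  show "antidiagonal (const2 c) = const1 c"
    by (simp add: antidiagonal_def const2_def const1_def op_subst_const1 additive_neg_lam)
qed

lemma op_subst_shift_const1: "op_subst (pCons 0) const1 p = p"
  by (induct p) (simp_all add: op_subst_pCons const1_def)

lemma antidiagonal_prod_right:
  assumes "lprod a 0 = 0"
  shows "antidiagonal (prod_right lprod lam_op a mu_op q) = op_subst neg_lam (lprod a) q"
proof -
  have at: "antidiagonal (at_op lprod lam_op a w) = lprod a w" for w
    unfolding at_op_def
    by (subst op_subst_hom[where F = antidiagonal and T' = "pCons 0"])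
      (simp_all add: additive_antidiagonal antidiagonal_ops op_subst_shift_const1,
        simp add: const2_def)
  show ?thesis
    unfolding prod_right_def
    by (subst op_subst_hom[where F = antidiagonal and T' = neg_lam])
      (simp_all add: additive_antidiagonal additive_neg_lam antidiagonal_ops at,
        simp add: at_op_def assms const2_def)
qed

text \<open>
  On the line \<open>\<mu> = -\<lambda>\<close> the outer product of \<open>(a \<^sub>(\<^sub>\<lambda>\<^sub>) b) \<^sub>(\<^sub>\<lambda>\<^sub>+\<^sub>\<mu>\<^sub>) c\<close> is taken at \<open>0\<close>, so that only
  its constant term survives and no power of \<open>\<lambda>\<close> is contributed by it.
\<close>

lemma antidiagonal_prod_nest_left:
  assumes "lprod 0 c = 0"
  shows "antidiagonal (prod_nest_left lprod lam_op lam_plus_mu a b c) =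
    map_poly (\<lambda>u. coeff (lprod u c) 0) (lprod a b)"
proof -
  have at: "antidiagonal (at_op lprod lam_plus_mu u c) = const1 (coeff (lprod u c) 0)" for u
  proof -
    obtain r p where rp: "lprod u c = pCons r p" by (cases "lprod u c")
    show ?thesis
      by (simp add: at_op_def rp op_subst_pCons const2_def[of 0] additive.add[OF additive_antidiagonal]
          antidiagonal_ops)
  qed
  have "antidiagonal (prod_nest_left lprod lam_op lam_plus_mu a b c) =
      op_subst (pCons 0) (\<lambda>u. const1 (coeff (lprod u c) 0)) (lprod a b)"
    unfolding prod_nest_left_def
    by (subst op_subst_hom[where F = antidiagonal and T' = "pCons 0"])
      (simp_all add: additive_antidiagonal antidiagonal_ops at,
        simp add: at_op_def assms const2_def)
  also have "\<dots> = op_subst (pCons 0) const1 (map_poly (\<lambda>u. coeff (lprod u c) 0) (lprod a b))"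
    by (rule op_subst_map_poly[symmetric]) (simp_all add: assms const1_def)
  finally show ?thesis by (simp add: op_subst_shift_const1)
qed

lemma additive_of_linear: "Vector_Spaces.linear s t f \<Longrightarrow> additive f"
  by (simp add: additive_def Vector_Spaces.linear_def module_hom_def module_hom_axioms_def)

context commutative_conformal_algebra
begin

lemma additive_lprod: "additive (\<lambda>a. lprod a b)" "additive (lprod a)"
  using additive_of_linear[OF linear_lprod_left] additive_of_linear[OF linear_lprod_right] .

lemma additive_d: "additive d"
  using additive_of_linear[OF linear_d] .

text \<open>
  By associativity at \<open>\<mu> = -\<lambda>\<close> this polynomial is \<open>(a \<^sub>(\<^sub>\<lambda>\<^sub>) b) \<^sub>(\<^sub>0\<^sub>) c\<close>; what matters is that the bound
  is uniform in \<open>c\<close>.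
\<close>

lemma degree_lprod_antidiagonal:
  "degree (op_subst neg_lam (lprod a) (lprod b c)) \<le> degree (lprod a b)"
proof -
  have "op_subst neg_lam (lprod a) (lprod b c) = map_poly (\<lambda>u. coeff (lprod u c) 0) (lprod a b)"
    using arg_cong[OF conformal_assoc, of antidiagonal a b c]
    by (simp add: antidiagonal_prod_right antidiagonal_prod_nest_left
        additive.zero[OF additive_lprod(1)] additive.zero[OF additive_lprod(2)])
  then show ?thesis by (simp add: map_poly_degree_leq)
qed

text \<open>
  Commutativity turns \<open>\<partial> + \<lambda>\<close> into \<open>- \<lambda>\<close>, because \<open>\<partial> + (- \<partial> - \<lambda>) = - \<lambda>\<close>.
\<close>

lemma lprod_commuted_power:
  assumes "lprod b a = ((\<lambda>p. map_poly d p + pCons 0 p) ^^ k) [:v:]"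
  shows "lprod a b = (neg_lam ^^ k) [:v:]"
proof -
  let ?S = "op_subst (neg_d_var d) const1"
  have S_d: "?S (map_poly d p) = map_poly d (?S p)" for p
  proof -
    have "?S (map_poly d p) = op_subst (neg_d_var d) (\<lambda>c. const1 (d c)) p"
      by (rule op_subst_map_poly)
        (simp_all add: additive_d additive.zero[OF additive_d] const1_def)
    also have "\<dots> = op_subst (neg_d_var d) (\<lambda>c. map_poly d (const1 c)) p"
      by (rule op_subst_cong) (simp add: const1_def map_poly_pCons additive.zero[OF additive_d])
    also have "\<dots> = map_poly d (?S p)"
      by (rule op_subst_hom[symmetric])
        (simp_all add: additive_d additive_map_poly const1_def,
          simp add: neg_d_var_def additive_d
          additive.minus[OF additive_map_poly] additive.diff[OF additive_map_poly]
          map_poly_pCons0 additive.zero[OF additive_d])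
    finally show ?thesis .
  qed
  have S_shift: "?S (pCons 0 p) = neg_d_var d (?S p)" for p
    by (subst op_subst_pCons) (simp_all add: additive_d const1_def)
  have "?S (map_poly d p + pCons 0 p) = neg_lam (?S p)" for p
    by (simp add: op_subst_add additive_d S_d S_shift)
      (simp add: neg_d_var_def neg_lam_def)
  then have "?S (((\<lambda>p. map_poly d p + pCons 0 p) ^^ k) [:v:]) = (neg_lam ^^ k) (?S [:v:])"
    by (induct k) simp_all
  also have "?S [:v:] = [:v:]"
    by (subst op_subst_const1) (simp_all add: additive_d const1_def)
  finally show ?thesis
    using conformal_comm[of a b] assms by simp
qed

text \<open>
  Under the hypotheses, the product \<open>x \<^sub>(\<^sub>\<lambda>\<^sub>) (x \<^sub>(\<^sub>-\<^sub>\<lambda>\<^sub>) Dv)\<close> is \<open>\<lambda>\<^sup>k (x \<^sub>(\<^sub>\<lambda>\<^sub>) v)\<close>. Applying \<open>D\<close> to it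
  makes the unknown factor \<open>x \<^sub>(\<^sub>\<lambda>\<^sub>) v\<close> explicit and cannot raise the degree in \<open>\<lambda>\<close>.
\<close>

lemma degree_lprod_self_ge:
  assumes D: "conformal_derivation scale d lprod D"
    and Dx_v: "lprod (D x) v = 0"
    and x_Dv: "lprod x (D v) = (neg_lam ^^ k) [:v:]"
    and "v \<noteq> 0"
  shows "2 * k \<le> degree (lprod x x)"
proof -
  have leibniz: "map_poly D (lprod a b) = lprod (D a) b + lprod a (D b)" for a b
    using D by (simp add: conformal_derivation_def)
  have D0: "D 0 = 0"
    using D by (auto simp: conformal_derivation_def intro: additive.zero[OF additive_of_linear])
  let ?q = "op_subst neg_lam (lprod x) (lprod x (D v))"
  have "?q = (pCons 0 ^^ k) (lprod x v)"
    by (simp add: x_Dv op_subst_neg_lam_funpow additive_lprod op_subst_const1 additive_neg_lam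
        additive.zero[OF additive_lprod(2)])
  then have "map_poly D ?q = (pCons 0 ^^ k) ((neg_lam ^^ k) [:v:])"
    by (simp add: map_poly_shift_funpow D0 leibniz Dx_v x_Dv)
  moreover have "(neg_lam ^^ k) [:v:] \<noteq> 0"
    using \<open>v \<noteq> 0\<close> by (induct k) (simp_all add: neg_lam_def)
  ultimately have "2 * k = degree (map_poly D ?q)"
    using \<open>v \<noteq> 0\<close> by (simp add: degree_shift_funpow degree_neg_lam_funpow)
  also have "\<dots> \<le> degree ?q"
    by (rule map_poly_degree_leq)
  also have "\<dots> \<le> degree (lprod x x)"
    by (rule degree_lprod_antidiagonal)
  finally show ?thesis .
qed

end

text \<open>
  In characteristic zero the factorials relating \<open>n\<close>-products to coefficients can be cancelled.
\<close>

lemma conformal_embedding_lprod: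
  assumes "vector_space scaleC"
    and "conformal_embedding scaleB dB lprodB scaleC dC lprodC \<phi>"
  shows "lprodC (\<phi> a) (\<phi> b) = map_poly \<phi> (lprodB a b)"
proof (rule poly_eqI)
  fix n
  interpret vector_space scaleC by fact
  have lin: "Vector_Spaces.linear scaleB scaleC \<phi>"
    and "\<phi> (nprod scaleB lprodB n a b) = nprod scaleC lprodC n (\<phi> a) (\<phi> b)"
    using assms(2) by (auto simp: conformal_embedding_def)
  then have "scaleC (fact n) (\<phi> (coeff (lprodB a b) n)) =
      scaleC (fact n) (coeff (lprodC (\<phi> a) (\<phi> b)) n)"
    by (simp add: nprod_def Vector_Spaces.linear_def module_hom_def module_hom_axioms_def)
  then show "coeff (lprodC (\<phi> a) (\<phi> b)) n = coeff (map_poly \<phi> (lprodB a b)) n"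
    by (simp add: coeff_map_poly additive.zero[OF additive_of_linear[OF lin]])
qed

theorem proposition4p4:
  fixes scale :: "'k::field_char_0 \<Rightarrow> 'c::ab_group_add \<Rightarrow> 'c"
    and d :: "'c \<Rightarrow> 'c"
    and lprod :: "'c \<Rightarrow> 'c \<Rightarrow> 'c poly"
    and D :: "'c \<Rightarrow> 'c"
  assumes "commutative_conformal_algebra scale d lprod"
    and "conformal_derivation scale d lprod D"
  shows "\<not> (\<exists>\<phi> :: 'k W \<Rightarrow> 'c.
    conformal_embedding W_scale W_d W_lprod scale d (derived_lprod lprod D) \<phi>)"
proof
  interpret C: commutative_conformal_algebra scale d lprod by fact
  assume "\<exists>\<phi> :: 'k W \<Rightarrow> 'c.
    conformal_embedding W_scale W_d W_lprod scale d (derived_lprod lprod D) \<phi>"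
  then obtain \<phi> :: "'k W \<Rightarrow> 'c" where
    emb: "conformal_embedding W_scale W_d W_lprod scale d (derived_lprod lprod D) \<phi>" ..
  have add: "additive \<phi>" and "inj \<phi>" and \<phi>_d: "\<phi> (W_d a) = d (\<phi> a)" for a
    using emb by (auto simp: conformal_embedding_def intro: additive_of_linear)
  have prod: "lprod (D (\<phi> a)) (\<phi> b) = map_poly \<phi> (W_lprod a b)" for a b
    using conformal_embedding_lprod[OF C.vector_space_axioms emb]
    by (simp add: derived_lprod_def)
  define x where "x = \<phi> (W_of X)"
  have "2 * k \<le> degree (lprod x x)" for k
  proof (rule C.degree_lprod_self_ge[OF assms(2)])
    let ?v = "\<phi> (W_of (V k))"
    show "lprod (D x) ?v = 0"
      by (simp add: x_def prod W_lprod_generators)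
    have "map_poly \<phi> (W_d_plus_lam p) = map_poly d (map_poly \<phi> p) + pCons 0 (map_poly \<phi> p)" for p
      by (simp add: W_d_plus_lam_def additive.add[OF additive_map_poly] add \<phi>_d map_poly_map_poly
          additive.zero[OF add] additive.zero[OF C.additive_d] o_def map_poly_pCons0)
    then have "map_poly \<phi> ((W_d_plus_lam ^^ j) [:W_of (V k):]) =
        ((\<lambda>p. map_poly d p + pCons 0 p) ^^ j) [:?v:]" for j
      by (induct j) (simp_all add: map_poly_pCons additive.zero[OF add])
    then have "lprod (D ?v) x = ((\<lambda>p. map_poly d p + pCons 0 p) ^^ k) [:?v:]"
      by (simp add: x_def prod W_lprod_generators)
    then show "lprod x (D ?v) = (neg_lam ^^ k) [:?v:]"
      by (rule C.lprod_commuted_power)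
    have "W_of (V k) \<noteq> (0 :: 'k W)"
      by (metis W_of_def lookup_single_eq lookup_zero one_neq_zero)
    then show "?v \<noteq> 0"
      using \<open>inj \<phi>\<close> additive.zero[OF add] by (metis injD)
  qed
  from this[of "Suc (degree (lprod x x))"] show False by simp
qed

end
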